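(* Let $a\ge1$ be real, $\alpha>\beta>0$, $T>0$, $\delta>0$. Let $u_0,u_1$ be functions on $[0,\delta]$ satisfying, for all $x\in[0,\delta]$, $$K_0x^\alpha\le u_0(x)\le K_1x^\alpha,\qquad K_2x^\beta\le u_1(x)\le K_3x^\beta,$$ with positive constants $K_0,\dots,K_3$. Let $u$ be a solution of $$u_{tt}=\bigl(u^{2a}u_x\bigr)_x,\qquad u(0,x)=u_0(x),\quad u_t(0,x)=u_1(x),$$ such that $$u\in C^2([0,T]\times(0,\delta])\cap C([0,T]\times[0,\delta]),\qquad u_t,\ u^{a-1}u_x\in C([0,T]\times[0,\delta]),$$ $$u(t,0)=u_t(t,0)=0\ \ (t\in[0,T]),\qquad u(t,x)\ge0\ \ ((t,x)\in[0,T]\times[0,\delta]).$$ Then, provided that $T>0$ is sufficiently small, $u$ satisfies $$C_1\,t\,x^\beta\le u(t,x)\le C_2\,x^\beta .$$ That is, there exist $T_1\in(0,T]$, $\delta_1\in(0,\delta)$ and constants $C_1,C_2>0$ such that this estimate holds for all $(t,x)\in[0,T_1]\times[0,\delta_1]$.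
   Context: All functions are real-valued. The equation is required to hold pointwise for $(t,x)\in[0,T]\times(0,\delta]$, with one-sided derivatives at the endpoints $t=0$, $t=T$, $x=\delta$. The conditions $u_t,\ u^{a-1}u_x\in C([0,T]\times[0,\delta])$ mean that these functions, defined on $[0,T]\times(0,\delta]$, extend continuously up to $x=0$ (for $a=1$, $u^{a-1}=1$). The numbers $T_1,\delta_1,C_1,C_2$ may depend on the data, the constants and the solution $u$, but not on $(t,x)$. *)

theory Defs
  imports "HOL-Analysis.Analysis"
begin

text \<open>Partial derivatives on $[0,T] \times (0,\delta]$, one-sided at $t = 0$, $t = T$ and
  $x = \delta$. They are only meaningful together with differentiability, as in \<open>C1_strip\<close>.\<close>

definition Dt :: "real \<Rightarrow> (real \<Rightarrow> real \<Rightarrow> real) \<Rightarrow> real \<Rightarrow> real \<Rightarrow> real"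
  where "Dt T f t x = vector_derivative (\<lambda>s. f s x) (at t within {0..T})"

definition Dx :: "real \<Rightarrow> (real \<Rightarrow> real \<Rightarrow> real) \<Rightarrow> real \<Rightarrow> real \<Rightarrow> real"
  where "Dx \<delta> f t x = vector_derivative (\<lambda>y. f t y) (at x within {0<..\<delta>})"

definition C0_strip :: "real \<Rightarrow> real \<Rightarrow> (real \<Rightarrow> real \<Rightarrow> real) \<Rightarrow> bool"
  where "C0_strip T \<delta> f \<longleftrightarrow> continuous_on ({0..T} \<times> {0<..\<delta>}) (\<lambda>(t, x). f t x)"

definition C1_strip :: "real \<Rightarrow> real \<Rightarrow> (real \<Rightarrow> real \<Rightarrow> real) \<Rightarrow> bool"
  where "C1_strip T \<delta> f \<longleftrightarrow>
    C0_strip T \<delta> f \<and>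
    (\<forall>t\<in>{0..T}. \<forall>x\<in>{0<..\<delta>}.
        (\<lambda>s. f s x) differentiable (at t within {0..T}) \<and>
        (\<lambda>y. f t y) differentiable (at x within {0<..\<delta>})) \<and>
    C0_strip T \<delta> (Dt T f) \<and> C0_strip T \<delta> (Dx \<delta> f)"

definition C2_strip :: "real \<Rightarrow> real \<Rightarrow> (real \<Rightarrow> real \<Rightarrow> real) \<Rightarrow> bool"
  where "C2_strip T \<delta> f \<longleftrightarrow>
    C1_strip T \<delta> f \<and> C1_strip T \<delta> (Dt T f) \<and> C1_strip T \<delta> (Dx \<delta> f)"

text \<open>\<open>g\<close> is a continuous function on $[0,T] \times [0,\delta]$ extending \<open>f\<close>, whose values at
  $x = 0$ are disregarded. Such a \<open>g\<close> is unique on $[0,T] \times [0,\delta]$ when $\delta > 0$.\<close>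

definition continuous_extension ::
    "real \<Rightarrow> real \<Rightarrow> (real \<Rightarrow> real \<Rightarrow> real) \<Rightarrow> (real \<Rightarrow> real \<Rightarrow> real) \<Rightarrow> bool"
  where "continuous_extension T \<delta> f g \<longleftrightarrow>
    continuous_on ({0..T} \<times> {0..\<delta>}) (\<lambda>(t, x). g t x) \<and>
    (\<forall>t\<in>{0..T}. \<forall>x\<in>{0<..\<delta>}. g t x = f t x)"

text \<open>The power $s^r$ for $s, r \ge 0$ with $s^0 = 1$ also at $s = 0$, where \<open>0 powr 0 = 0\<close>.\<close>

definition rpow :: "real \<Rightarrow> real \<Rightarrow> real"
  where "rpow s r = (if r = 0 then 1 else s powr r)"

text \<open>The equation $u_{tt} = (u^{2a} u_x)_x$, including the existence of the outer derivative.\<close>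

definition solves_wave_eq :: "real \<Rightarrow> real \<Rightarrow> real \<Rightarrow> (real \<Rightarrow> real \<Rightarrow> real) \<Rightarrow> bool"
  where "solves_wave_eq a T \<delta> u \<longleftrightarrow>
    (\<forall>t\<in>{0..T}. \<forall>x\<in>{0<..\<delta>}.
      ((\<lambda>y. u t y powr (2 * a) * Dx \<delta> u t y) has_real_derivative Dt T (Dt T u) t x)
        (at x within {0<..\<delta>}))"

end

theory Submission imports Defs
begin

text \<open>The Riemann invariants \<open>R = u_t + s u^a u_x\<close>, \<open>s = 1\<close> or \<open>s = -1\<close>, satisfy
  \<open>R_t - s u^a R_x = s (a u^(a-1) u_x) R\<close> wherever \<open>u > 0\<close>. The coefficient on the right is
  bounded because \<open>u^(a-1) u_x\<close> extends continuously to \<open>x = 0\<close>; for the same reason the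
  speed \<open>u^a\<close> is at most \<open>L x\<close> with \<open>L = a M\<close>, where \<open>M\<close> bounds \<open>\<bar>u^(a-1) u_x\<bar>\<close>. Initially
  \<open>\<bar>u^a u_x\<bar> \<le> M u0\<close> is negligible against \<open>u1\<close> near \<open>x = 0\<close> since \<open>\<alpha> > \<beta>\<close>, so both invariants
  are comparable to \<open>x^\<beta>\<close>. A first-time comparison with the barriers \<open>c x^\<beta> exp(K t)\<close> and
  \<open>c x^\<beta> exp(-K t)\<close> preserves this, and \<open>u_t\<close>, the mean of the two invariants, is integrated
  in time. Instead of solving for characteristics, the comparison differentiates along straight backward segments at the
  first bad point.\<close>

section \<open>Calculus on the half-open strip\<close>

lemma C0_stripD:
  "C0_strip T \<delta> f \<Longrightarrow> continuous_on ({0..T} \<times> {0<..\<delta>}) (\<lambda>p. f (fst p) (snd p))"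
  by (simp add: C0_strip_def case_prod_unfold)

lemma C1_stripD:
  assumes "C1_strip T \<delta> f"
  shows "C0_strip T \<delta> f" "C0_strip T \<delta> (Dt T f)" "C0_strip T \<delta> (Dx \<delta> f)"
  using assms by (auto simp: C1_strip_def)

lemma C2_stripD:
  assumes "C2_strip T \<delta> f"
  shows "C1_strip T \<delta> f" "C1_strip T \<delta> (Dt T f)" "C1_strip T \<delta> (Dx \<delta> f)"
  using assms by (auto simp: C2_strip_def)

lemma Dt_has_derivative:
  assumes "C1_strip T \<delta> f" "t \<in> {0..T}" "x \<in> {0<..\<delta>}"
  shows "((\<lambda>s. f s x) has_real_derivative Dt T f t x) (at t within {0..T})"
  using assms
  by (auto simp: C1_strip_def Dt_def has_real_derivative_iff_has_vector_derivative
      vector_derivative_works[symmetric])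

lemma Dx_has_derivative:
  assumes "C1_strip T \<delta> f" "t \<in> {0..T}" "x \<in> {0<..\<delta>}"
  shows "((\<lambda>y. f t y) has_real_derivative Dx \<delta> f t x) (at x within {0<..\<delta>})"
  using assms
  by (auto simp: C1_strip_def Dx_def has_real_derivative_iff_has_vector_derivative
      vector_derivative_works[symmetric])

lemma real_mvt:
  fixes f :: "real \<Rightarrow> real"
  assumes "p < q" "{p..q} \<subseteq> S"
    and "\<And>x. x \<in> {p..q} \<Longrightarrow> (f has_real_derivative f' x) (at x within S)"
  obtains x where "x \<in> {p<..<q}" "f q - f p = (q - p) * f' x"
proof -
  have "\<exists>x\<in>{p<..<q}. f q - f p = f' x * (q - p)"
  proof (rule mvt_simple[OF \<open>p < q\<close>])
    fix x assume "p \<le> x" "x \<le> q"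
    then have "(f has_real_derivative f' x) (at x within {p..q})"
      using assms by (intro DERIV_subset[OF assms(3)]) auto
    then show "(f has_derivative (*) (f' x)) (at x within {p..q})"
      by (simp add: has_field_derivative_def)
  qed
  with that show ?thesis by (auto simp: mult.commute)
qed

text \<open>Partial derivatives, with the one in \<open>x\<close> continuous, give joint
  differentiability, one-sided edges included. This is what permits a chain rule along slanted
  segments.\<close>

lemma C1_strip_has_derivative:
  assumes f: "C1_strip T \<delta> f" and t: "t \<in> {0..T}" and x: "x \<in> {0<..\<delta>}"
  shows "((\<lambda>(t, x). f t x) has_derivative (\<lambda>(dt, dx). Dt T f t x * dt + Dx \<delta> f t x * dx))
    (at (t, x) within {0..T} \<times> {0<..\<delta>})"
proof -
  have "((\<lambda>(t, x). f t x) has_derivative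
      (\<lambda>(dt, dx). Dt T f t x * dt + blinfun_mult_right (Dx \<delta> f t x) dx))
    (at (t, x) within {0..T} \<times> {0<..\<delta>})"
  proof (rule has_derivative_partialsI[where fy = "\<lambda>t x. blinfun_mult_right (Dx \<delta> f t x)"])
    show "((\<lambda>t. f t x) has_derivative (*) (Dt T f t x)) (at t within {0..T})"
      using Dt_has_derivative[OF f t x] by (simp add: has_field_derivative_def)
    show "((\<lambda>x. f t x) has_derivative blinfun_mult_right (Dx \<delta> f t x)) (at x within {0<..\<delta>})"
      if "t \<in> {0..T}" "x \<in> {0<..\<delta>}" for t x
      using Dx_has_derivative[OF f that] by (simp add: has_field_derivative_def)
    have "continuous_on ({0..T} \<times> {0<..\<delta>}) (\<lambda>(t, x). blinfun_mult_right (Dx \<delta> f t x))"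
      unfolding case_prod_unfold
      by (intro bounded_linear.continuous_on[OF bounded_linear_blinfun_mult_right]
          C0_stripD C1_stripD[OF f])
    then show "continuous (at (t, x) within {0..T} \<times> {0<..\<delta>})
        (\<lambda>(t, x). blinfun_mult_right (Dx \<delta> f t x))"
      using t x by (auto simp: continuous_on_eq_continuous_within)
  qed (use x in auto)
  then show ?thesis by simp
qed

text \<open>Chain rule at the upper end of a segment running backward in time. The derivative is
  one-sided in \<open>h\<close>, so the segment may start at \<open>t = T\<close>.\<close>

lemma C1_strip_line:
  assumes f: "C1_strip T \<delta> f" and "0 < e"
    and line: "\<And>h. h \<in> {0..e} \<Longrightarrow> t - h \<in> {0..T} \<and> x + c * h \<in> {0<..\<delta>}"
  shows "((\<lambda>h. f (t - h) (x + c * h)) has_real_derivative c * Dx \<delta> f t x - Dt T f t x)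
    (at 0 within {0..e})"
proof -
  have tx: "t \<in> {0..T}" "x \<in> {0<..\<delta>}" using line[of 0] \<open>0 < e\<close> by auto
  have "((\<lambda>h. (t - h, x + c * h)) has_derivative (\<lambda>h. (- h, c * h))) (at 0 within {0..e})"
    by (auto intro!: derivative_eq_intros)
  moreover have "((\<lambda>(t, x). f t x) has_derivative
      (\<lambda>(dt, dx). Dt T f t x * dt + Dx \<delta> f t x * dx))
      (at (t - 0, x + c * 0) within (\<lambda>h. (t - h, x + c * h)) ` {0..e})"
    using has_derivative_subset[OF C1_strip_has_derivative[OF f tx],
        of "(\<lambda>h. (t - h, x + c * h)) ` {0..e}"] line
    by (simp add: image_subset_iff)
  ultimately have "((\<lambda>h. (\<lambda>(t, x). f t x) (t - h, x + c * h)) has_derivative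
      (\<lambda>h. (\<lambda>(dt, dx). Dt T f t x * dt + Dx \<delta> f t x * dx) (- h, c * h))) (at 0 within {0..e})"
    by (rule has_derivative_in_compose)
  then show ?thesis
    unfolding has_field_derivative_def prod.case
    by (rule has_derivative_eq_rhs) (simp add: fun_eq_iff algebra_simps)
qed

text \<open>Schwarz's theorem via the second difference of \<open>f\<close> over the square
  [t - h, t] x [x, x + h]. Stepping backward in time keeps the square in the strip also for
  \<open>t = T\<close>.\<close>

lemma Dx_Dt_eq_Dt_Dx:
  assumes f: "C2_strip T \<delta> f" and t: "0 < t" "t \<le> T" and x: "0 < x" "x < \<delta>"
  shows "Dx \<delta> (Dt T f) t x = Dt T (Dx \<delta> f) t x"
proof (rule ccontr)
  let ?S = "{0..T} \<times> {0<..\<delta>}" and ?A = "Dx \<delta> (Dt T f)" and ?B = "Dt T (Dx \<delta> f)"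
  note C = C2_stripD[OF f]
  assume neq: "?A t x \<noteq> ?B t x"
  \<comment> \<open>Half the gap: if each mixed derivative varies by less than \<open>e\<close> and
    they agree somewhere nearby, the gap is less than \<open>2 * e\<close>, which is absurd.\<close>
  define e where "e = \<bar>?A t x - ?B t x\<bar> / 2"
  have "e > 0" using neq by (simp add: e_def)
  have txS: "(t, x) \<in> ?S" using t x by auto
  have "\<exists>d>0. \<forall>s\<in>{0..T}. \<forall>y\<in>{0<..\<delta>}. \<bar>s - t\<bar> < d \<longrightarrow> \<bar>y - x\<bar> < d \<longrightarrow> \<bar>g s y - g t x\<bar> < e"
    if g: "C0_strip T \<delta> g" for g
  proof -
    from C0_stripD[OF g] txS \<open>e > 0\<close> obtain d where "d > 0" and
      d: "\<And>p. p \<in> ?S \<Longrightarrow> dist p (t, x) < d \<Longrightarrow> dist (g (fst p) (snd p)) (g t x) < e"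
      unfolding continuous_on_iff by fastforce
    have "\<bar>g s y - g t x\<bar> < e"
      if "s \<in> {0..T}" "y \<in> {0<..\<delta>}" "\<bar>s - t\<bar> < d / 2" "\<bar>y - x\<bar> < d / 2" for s y
    proof -
      have "dist (s, y) (t, x) \<le> \<bar>s - t\<bar> + \<bar>y - x\<bar>"
        unfolding dist_prod_def by (rule order_trans[OF sqrt_sum_squares_le_sum_abs]) (simp add: dist_real_def)
      also have "\<dots> < d" using that by simp
      finally show ?thesis using d[of "(s, y)"] that by (simp add: dist_real_def)
    qed
    then show ?thesis using \<open>d > 0\<close> by (intro exI[of _ "d / 2"]) auto
  qed
  from this[OF C1_stripD(3)[OF C(2)]] this[OF C1_stripD(2)[OF C(3)]]
  obtain d1 d2 where "d1 > 0" "d2 > 0"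
    and d1: "\<And>s y. s \<in> {0..T} \<Longrightarrow> y \<in> {0<..\<delta>} \<Longrightarrow> \<bar>s - t\<bar> < d1 \<Longrightarrow> \<bar>y - x\<bar> < d1 \<Longrightarrow> \<bar>?A s y - ?A t x\<bar> < e"
    and d2: "\<And>s y. s \<in> {0..T} \<Longrightarrow> y \<in> {0<..\<delta>} \<Longrightarrow> \<bar>s - t\<bar> < d2 \<Longrightarrow> \<bar>y - x\<bar> < d2 \<Longrightarrow> \<bar>?B s y - ?B t x\<bar> < e"
    by metis
  define h where "h = Min {t, \<delta> - x, d1, d2} / 2"
  have h: "0 < h" "h < t" "h < \<delta> - x" "h < d1" "h < d2"
    using t x \<open>d1 > 0\<close> \<open>d2 > 0\<close> by (auto simp: h_def min_def)
  \<comment> \<open>The mean value theorem, used first in time then in space, and afterwards in the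
    other order, writes the same second difference as \<open>h * h\<close> times a value of each
    mixed derivative.\<close>
  obtain \<tau> where \<tau>: "\<tau> \<in> {t - h<..<t}"
    and e1: "(f t (x + h) - f t x) - (f (t - h) (x + h) - f (t - h) x)
      = (t - (t - h)) * (Dt T f \<tau> (x + h) - Dt T f \<tau> x)"
    by (rule real_mvt[of "t - h" t "{0..T}" "\<lambda>s. f s (x + h) - f s x"
          "\<lambda>s. Dt T f s (x + h) - Dt T f s x"])
      (use h t x in \<open>auto intro!: DERIV_diff Dt_has_derivative[OF C(1)]\<close>)
  obtain \<xi> where \<xi>: "\<xi> \<in> {x<..<x + h}"
    and e2: "Dt T f \<tau> (x + h) - Dt T f \<tau> x = (x + h - x) * ?A \<tau> \<xi>"
    by (rule real_mvt[of x "x + h" "{0<..\<delta>}" "\<lambda>y. Dt T f \<tau> y" "\<lambda>y. ?A \<tau> y"])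
      (use h t x \<tau> in \<open>auto intro!: Dx_has_derivative[OF C(2)]\<close>)
  obtain \<eta> where \<eta>: "\<eta> \<in> {x<..<x + h}"
    and e3: "(f t (x + h) - f (t - h) (x + h)) - (f t x - f (t - h) x)
      = (x + h - x) * (Dx \<delta> f t \<eta> - Dx \<delta> f (t - h) \<eta>)"
    by (rule real_mvt[of x "x + h" "{0<..\<delta>}" "\<lambda>y. f t y - f (t - h) y"
          "\<lambda>y. Dx \<delta> f t y - Dx \<delta> f (t - h) y"])
      (use h t x in \<open>auto intro!: DERIV_diff Dx_has_derivative[OF C(1)]\<close>)
  obtain \<sigma> where \<sigma>: "\<sigma> \<in> {t - h<..<t}"
    and e4: "Dx \<delta> f t \<eta> - Dx \<delta> f (t - h) \<eta> = (t - (t - h)) * ?B \<sigma> \<eta>"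
    by (rule real_mvt[of "t - h" t "{0..T}" "\<lambda>s. Dx \<delta> f s \<eta>" "\<lambda>s. ?B s \<eta>"])
      (use h t x \<eta> in \<open>auto intro!: Dt_has_derivative[OF C(3)]\<close>)
  have "h * (h * ?A \<tau> \<xi>) = f t (x + h) - f t x - f (t - h) (x + h) + f (t - h) x"
    using e1 unfolding e2 by simp
  moreover have "h * (h * ?B \<sigma> \<eta>) = f t (x + h) - f t x - f (t - h) (x + h) + f (t - h) x"
    using e3 unfolding e4 by simp
  ultimately have "h * (h * ?A \<tau> \<xi>) = h * (h * ?B \<sigma> \<eta>)" by linarith
  then have "?A \<tau> \<xi> = ?B \<sigma> \<eta>" using h by simp
  moreover have "\<bar>?A \<tau> \<xi> - ?A t x\<bar> < e" "\<bar>?B \<sigma> \<eta> - ?B t x\<bar> < e"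
    using h t x \<tau> \<xi> \<eta> \<sigma> by (auto intro!: d1 d2)
  ultimately show False using neq unfolding e_def by (simp add: abs_if field_simps split: if_splits)
qed

section \<open>Riemann invariants in characteristic directions\<close>

definition riemann_inv ::
    "real \<Rightarrow> real \<Rightarrow> real \<Rightarrow> (real \<Rightarrow> real \<Rightarrow> real) \<Rightarrow> real \<Rightarrow> real \<Rightarrow> real \<Rightarrow> real"
  where "riemann_inv a T \<delta> u s t x = Dt T u t x + s * u t x powr a * Dx \<delta> u t x"

text \<open>Positivity makes the power differentiable, and \<open>x < \<delta>\<close> makes the
  \<open>x\<close>-derivative two-sided, so the product rule can be compared with the equation by
  uniqueness.\<close>

lemma wave_eq_expanded:
  assumes u: "C2_strip T \<delta> u" and eq: "solves_wave_eq a T \<delta> u"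
    and t: "t \<in> {0..T}" and x: "0 < x" "x < \<delta>" and pos: "u t x > 0"
  shows "Dt T (Dt T u) t x
    = 2 * a * u t x powr (2 * a - 1) * (Dx \<delta> u t x)\<^sup>2 + u t x powr (2 * a) * Dx \<delta> (Dx \<delta> u) t x"
proof -
  note C = C2_stripD[OF u]
  have at: "at x within {0<..\<delta>} = at x"
    by (rule at_within_nhd[of x "{0<..<\<delta>}"]) (use x in auto)
  have du: "((\<lambda>y. u t y) has_real_derivative Dx \<delta> u t x) (at x)"
    and dv: "((\<lambda>y. Dx \<delta> u t y) has_real_derivative Dx \<delta> (Dx \<delta> u) t x) (at x)"
    using Dx_has_derivative[OF C(1) t, of x] Dx_has_derivative[OF C(3) t, of x] x at by auto
  have "((\<lambda>y. u t y powr (2 * a) * Dx \<delta> u t y) has_real_derivative Dt T (Dt T u) t x) (at x)"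
    using eq[unfolded solves_wave_eq_def, rule_format, OF t, of x] x at by simp
  moreover have "((\<lambda>y. u t y powr (2 * a) * Dx \<delta> u t y) has_real_derivative
      2 * a * u t x powr (2 * a - 1) * Dx \<delta> u t x * Dx \<delta> u t x
        + Dx \<delta> (Dx \<delta> u) t x * u t x powr (2 * a)) (at x)"
    using DERIV_mult[OF DERIV_fun_powr[OF du pos, of "2 * a"] dv] by simp
  ultimately show ?thesis using DERIV_unique by (fastforce simp: power2_eq_square)
qed

text \<open>The slope of the segment is frozen at the characteristic speed of its starting point, so
  at \<open>h = 0\<close> the derivative is the characteristic one. The mixed derivatives cancel by
  symmetry, the equation removes the remaining second derivatives, and the terms left over factor
  through the invariant.\<close>

lemma riemann_inv_line_derivative:
  assumes u: "C2_strip T \<delta> u" and eq: "solves_wave_eq a T \<delta> u"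
    and t: "0 < t" "t \<le> T" and x: "0 < x" "x < \<delta>" and pos: "u t x > 0" and s: "s\<^sup>2 = 1"
    and e: "0 < e"
    and line: "\<And>h. h \<in> {0..e} \<Longrightarrow> t - h \<in> {0..T} \<and> x + s * u t x powr a * h \<in> {0<..\<delta>}"
  shows "((\<lambda>h. riemann_inv a T \<delta> u s (t - h) (x + s * u t x powr a * h)) has_real_derivative
      - (s * (a * u t x powr (a - 1) * Dx \<delta> u t x) * riemann_inv a T \<delta> u s t x))
    (at 0 within {0..e})"
proof -
  note C = C2_stripD[OF u]
  define k q where "k = u t x powr a" and "q = Dx \<delta> u t x"
  let ?L = "\<lambda>g h. g (t - h) (x + s * k * h)"
  have D: "(?L g has_real_derivative s * k * Dx \<delta> g t x - Dt T g t x) (at 0 within {0..e})"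
    if "C1_strip T \<delta> g" for g
    using C1_strip_line[OF that e line] by (simp add: k_def)
  have "((\<lambda>h. ?L u h powr a) has_real_derivative
      a * u t x powr (a - 1) * (s * k * q - Dt T u t x)) (at 0 within {0..e})"
    using DERIV_chain2[OF has_real_derivative_powr[of "?L u 0" a] D[OF C(1)]] pos
    by (simp add: q_def)
  from DERIV_add[OF D[OF C(2)] DERIV_mult[OF DERIV_cmult[OF this, of s] D[OF C(3)]]]
  have *: "(?L (riemann_inv a T \<delta> u s) has_real_derivative
      s * k * Dx \<delta> (Dt T u) t x - Dt T (Dt T u) t x
      + (s * (a * u t x powr (a - 1) * (s * k * q - Dt T u t x)) * q
        + (s * k * Dx \<delta> (Dx \<delta> u) t x - Dt T (Dx \<delta> u) t x) * (s * k))) (at 0 within {0..e})"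
    by (simp add: riemann_inv_def k_def q_def)
  have p: "u t x powr (2 * a) = k\<^sup>2" "u t x powr (2 * a - 1) = k * u t x powr (a - 1)"
    by (simp_all add: k_def power2_eq_square powr_add[symmetric])
  have "Dt T (Dt T u) t x = 2 * a * (k * u t x powr (a - 1)) * q\<^sup>2 + k\<^sup>2 * Dx \<delta> (Dx \<delta> u) t x"
    using wave_eq_expanded[OF u eq _ x pos] t by (simp add: p q_def)
  moreover note Dx_Dt_eq_Dt_Dx[OF u t x]
  moreover have "s = 1 \<or> s = -1" using s by (simp add: power2_eq_1_iff)
  ultimately show ?thesis
    unfolding k_def[symmetric]
    by (intro DERIV_cong[OF *])
      (auto simp: riemann_inv_def k_def[symmetric] q_def[symmetric] algebra_simps power2_eq_square)
qed

section \<open>Linear degeneration of the speed and the comparison argument\<close>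

text \<open>Where u > 0, the \<open>x\<close>-derivative of u^a is \<open>a\<close> times the
  bounded quantity u^(a-1) u_x, and u^a vanishes at \<open>x = 0\<close>. A speed linear in
  \<open>x\<close> keeps characteristics from reaching \<open>x = 0\<close> in finite time.\<close>

lemma speed_bound:
  assumes u: "C1_strip T \<delta> u" and a: "a \<ge> 1" and t: "t \<in> {0..T}"
    and cont: "continuous_on {0..\<delta>} (u t)" and zero: "u t 0 = 0"
    and nonneg: "\<And>y. y \<in> {0..\<delta>} \<Longrightarrow> u t y \<ge> 0"
    and M: "\<And>y. y \<in> {0<..\<delta>} \<Longrightarrow> \<bar>rpow (u t y) (a - 1) * Dx \<delta> u t y\<bar> \<le> M"
    and x: "x \<in> {0<..\<delta>}"
  shows "u t x powr a \<le> a * M * x"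
proof (cases "u t x = 0")
  case True
  then show ?thesis using M[OF x] a x by (simp add: abs_le_iff)
next
  case False
  then have pos: "u t x > 0" using nonneg[of x] x by auto
  \<comment> \<open>\<open>u^a\<close> may fail to be differentiable at zeros of \<open>u\<close>: start from the last zero before \<open>x\<close>.\<close>
  define Z where "Z = {y \<in> {0..x}. u t y \<le> 0}"
  have cx: "continuous_on {0..x} (u t)" using cont x by (auto intro: continuous_on_subset)
  have "closed Z" unfolding Z_def
    by (intro continuous_on_closed_Collect_le cx continuous_on_const closed_atLeastAtMost)
  moreover have "bounded Z" unfolding Z_def
    by (rule bounded_subset[of "{0..x}"]) auto
  ultimately have "compact Z" by (simp add: compact_eq_bounded_closed)
  moreover have "0 \<in> Z" using zero x by (auto simp: Z_def)
  ultimately obtain z where "z \<in> Z" and zmax: "\<And>y. y \<in> Z \<Longrightarrow> y \<le> z"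
    using compact_attains_sup[of Z] by blast
  then have z: "0 \<le> z" "z < x" "u t z = 0"
    using nonneg[of z] pos x by (auto simp: Z_def less_le)
  have pos': "u t y > 0" if "z < y" "y \<le> x" for y
    using zmax[of y] that z by (force simp: Z_def)
  have "\<exists>\<xi>\<in>{z<..<x}. u t x powr a - u t z powr a
      = (\<lambda>h. a * u t \<xi> powr (a - 1) * Dx \<delta> u t \<xi> * h) (x - z)"
  proof (rule bexE[OF mvt[of z x "\<lambda>y. u t y powr a" "\<lambda>\<xi> h. a * u t \<xi> powr (a - 1) * Dx \<delta> u t \<xi> * h"]])
    show "z < x" by fact
    show "continuous_on {z..x} (\<lambda>y. u t y powr a)"
      using cx z x a nonneg
      by (intro continuous_on_powr' continuous_on_const) (auto intro: continuous_on_subset)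
    show "((\<lambda>y. u t y powr a) has_derivative (\<lambda>h. a * u t y powr (a - 1) * Dx \<delta> u t y * h)) (at y)"
      if "z < y" "y < x" for y
    proof -
      have at: "at y within {0<..\<delta>} = at y"
        by (rule at_within_nhd[of y "{0<..<\<delta>}"]) (use z x that in auto)
      have "(u t has_real_derivative Dx \<delta> u t y) (at y)"
        using Dx_has_derivative[OF u t, of y] at z x that by auto
      from DERIV_fun_powr[OF this pos', of a] that show ?thesis
        by (simp add: has_field_derivative_def)
    qed
  qed auto
  then obtain \<xi> where \<xi>: "z < \<xi>" "\<xi> < x"
    and eq: "u t x powr a = a * u t \<xi> powr (a - 1) * Dx \<delta> u t \<xi> * (x - z)"
    using z a by auto
  have "u t \<xi> powr (a - 1) * Dx \<delta> u t \<xi> \<le> M"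
    using M[of \<xi>] \<xi> z x pos'[of \<xi>] by (simp add: rpow_def split: if_splits)
  then have "u t x powr a \<le> a * M * (x - z)"
    unfolding eq using a z by (simp add: mult_right_mono mult.assoc mult_left_mono)
  also have "\<dots> \<le> a * M * x"
    using a z M[OF x] by (intro mult_left_mono) (auto simp: abs_le_iff)
  finally show ?thesis .
qed

text \<open>Here \<open>g\<close> is the margin to a barrier along a backward segment. Being
  positive at all earlier times, it has a nonnegative limit at \<open>h = 0\<close>; if it vanishes
  there, its difference quotients are positive and force \<open>d \<ge> 0\<close>.\<close>

lemma first_time_contradiction:
  fixes g :: "real \<Rightarrow> real"
  assumes e: "0 < e" and g: "(g has_real_derivative d) (at 0 within {0..e})"
    and pos: "\<And>h. 0 < h \<Longrightarrow> h \<le> e \<Longrightarrow> g h > 0" and "g 0 \<le> 0" and d: "g 0 = 0 \<Longrightarrow> d < 0"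
  shows False
proof -
  have nt: "at 0 within {0..e} \<noteq> bot"
    using e by (simp add: at_within_Icc_at_right)
  have "(g \<longlongrightarrow> g 0) (at 0 within {0..e})"
    using DERIV_continuous[OF g] by (simp add: continuous_within)
  then have "g 0 \<ge> 0"
    by (rule tendsto_lowerbound[OF _ _ nt])
      (use pos in \<open>auto simp: eventually_at_filter intro!: always_eventually less_imp_le\<close>)
  then have "d < 0" "g 0 = 0" using d \<open>g 0 \<le> 0\<close> by auto
  have "((\<lambda>h. (g h - g 0) / (h - 0)) \<longlongrightarrow> d) (at 0 within {0..e})"
    using g by (simp add: has_field_derivative_iff)
  then have "d \<ge> 0"
    by (rule tendsto_lowerbound[OF _ _ nt])
      (use pos \<open>g 0 = 0\<close> in \<open>auto simp: eventually_at_filter intro!: always_eventually less_imp_le\<close>)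
  with \<open>d < 0\<close> show False by simp
qed

text \<open>In \<open>K\<close>, the part \<open>L * \<beta>\<close> absorbs the change of the
  weight y^\<beta> under transport, \<open>L\<close> absorbs the zero-order term, and 1 makes the
  comparison strict. Positivity of \<open>u\<close> is given only initially and is recovered during
  the argument.\<close>

lemma riemann_inv_bounds:
  fixes a c1 c2 r M \<beta> x :: real
  defines "L \<equiv> a * M" and "K \<equiv> a * M * (1 + \<beta>) + 1"
  assumes a: "a \<ge> 1" and \<beta>: "\<beta> > 0" and T: "T > 0" and M: "M > 0"
    and u: "C2_strip T \<delta> u" and eq: "solves_wave_eq a T \<delta> u"
    and nonneg: "\<And>t y. t \<in> {0..T} \<Longrightarrow> y \<in> {0<..\<delta>} \<Longrightarrow> u t y \<ge> 0"
    and bound: "\<And>t y. t \<in> {0..T} \<Longrightarrow> y \<in> {0<..\<delta>} \<Longrightarrow> \<bar>rpow (u t y) (a - 1) * Dx \<delta> u t y\<bar> \<le> M"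
    and speed: "\<And>t y. t \<in> {0..T} \<Longrightarrow> y \<in> {0<..\<delta>} \<Longrightarrow> u t y powr a \<le> L * y"
    and c: "c1 > 0" "c2 > 0" and r: "r < \<delta>"
    and pos0: "\<And>y. y \<in> {0<..r} \<Longrightarrow> u 0 y > 0"
    and init: "\<And>y s. y \<in> {0<..r} \<Longrightarrow> s \<in> {-1, 1} \<Longrightarrow>
      c1 * y powr \<beta> < riemann_inv a T \<delta> u s 0 y \<and> riemann_inv a T \<delta> u s 0 y < c2 * y powr \<beta>"
    and x: "0 < x" "x \<le> r * exp (- (2 * L * T))" and t: "t \<in> {0..T}"
  shows "c1 * x powr \<beta> * exp (- (K * t)) < Dt T u t x"
    and "Dt T u t x < c2 * x powr \<beta> * exp (K * t)"
proof -
  note C = C2_stripD[OF u]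
  have L: "L > 0" using a M by (simp add: L_def)
  have K: "L * \<beta> + L < K" by (simp add: K_def L_def algebra_simps)
  \<comment> \<open>Backward segments of slope at most \<open>L x\<close> stay in \<open>D\<close> in both directions. The factor 2 is
    needed on the left side, where \<open>1 - L h \<ge> exp (- 2 L h)\<close> holds for small \<open>h\<close> but
    \<open>1 - L h \<ge> exp (- L h)\<close> fails.\<close>
  define D where "D = {p. 0 \<le> fst p \<and> fst p \<le> T \<and>
    x * exp (- (2 * L * T)) * exp (2 * L * fst p) \<le> snd p \<and> snd p \<le> r * exp (- (2 * L * fst p))}"
  \<comment> \<open>\<open>\<sigma> = 1\<close> is the upper and \<open>\<sigma> = -1\<close> the
    lower barrier. The sign in \<open>F\<close> turns all four inequalities, for two barriers and
    two invariants, into \<open>F > 0\<close>.\<close>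
  define \<psi> where "\<psi> \<sigma> t y = (if \<sigma> = 1 then c2 else c1) * y powr \<beta> * exp (\<sigma> * K * t)"
    for \<sigma> t y :: real
  define F where "F i p = snd i * (\<psi> (snd i) (fst p) (snd p) - riemann_inv a T \<delta> u (fst i) (fst p) (snd p))"
    for i p :: "real \<times> real"
  define I :: "(real \<times> real) set" where "I = {-1, 1} \<times> {-1, 1}"
  have \<psi>_pos: "\<psi> \<sigma> t y > 0" if "y > 0" for \<sigma> t y using c that by (simp add: \<psi>_def)
  have "0 < r * exp (- (2 * L * T))" using x by simp
  then have r0: "r > 0" by (simp add: zero_less_mult_iff)
  have D_strip: "\<tau> \<in> {0..T}" "0 < y" "y \<le> r" "y < \<delta>" if "(\<tau>, y) \<in> D" for \<tau> y
  proof -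
    have *: "0 \<le> \<tau>" "\<tau> \<le> T" "x * exp (- (2 * L * T)) * exp (2 * L * \<tau>) \<le> y"
      "y \<le> r * exp (- (2 * L * \<tau>))" using that by (auto simp: D_def)
    show "\<tau> \<in> {0..T}" using * by simp
    have "0 < x * exp (- (2 * L * T)) * exp (2 * L * \<tau>)" using x by simp
    then show "0 < y" using * by linarith
    have "r * exp (- (2 * L * \<tau>)) \<le> r * 1"
      using * L r0 by (intro mult_left_mono) auto
    then show "y \<le> r" using * by linarith
    then show "y < \<delta>" using r by simp
  qed
  \<comment> \<open>The left edge of \<open>D\<close> is positive, so \<open>D\<close> avoids
    \<open>x = 0\<close>, where no C^2 regularity is assumed, and is compact although the strip is
    not.\<close>
  have D_sub: "D \<subseteq> {0..T} \<times> {0<..\<delta>}"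
    using D_strip by (force simp: less_imp_le)
  have "closed D" unfolding D_def
    by (intro closed_Collect_conj closed_Collect_le continuous_intros)
  moreover have "bounded D"
  proof (rule bounded_subset)
    show "bounded ({0..T} \<times> {0..\<delta>})" by (intro bounded_Times bounded_closed_interval)
    show "D \<subseteq> {0..T} \<times> {0..\<delta>}" using D_sub by auto
  qed
  ultimately have "compact D" by (simp add: compact_eq_bounded_closed)
  have cont: "continuous_on D (F i)" for i :: "real \<times> real"
  proof -
    note R = continuous_on_subset[OF C0_stripD D_sub]
    note R' = R[OF C1_stripD(1)[OF C(1)]] R[OF C1_stripD(2)[OF C(1)]] R[OF C1_stripD(3)[OF C(1)]]
    have "\<forall>p\<in>D. u (fst p) (snd p) \<ge> 0"
      using D_strip nonneg by (auto simp: less_imp_le)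
    then have pu: "continuous_on D (\<lambda>p. u (fst p) (snd p) powr a)"
      using a by (intro continuous_on_powr' continuous_on_const R'(1)) auto
    have "\<forall>p\<in>D. snd p \<noteq> 0" using D_strip by force
    then have px: "continuous_on D (\<lambda>p. snd p powr \<beta>)"
      by (intro continuous_on_powr continuous_on_snd continuous_on_id continuous_on_const)
    have ex: "continuous_on D (\<lambda>p. exp (snd i * K * fst p))"
      by (intro continuous_intros)
    show ?thesis
      unfolding F_def \<psi>_def riemann_inv_def
      by (intro continuous_on_mult continuous_on_add continuous_on_diff continuous_on_const
          pu px ex R')
  qed
  have F_pos: "F i p > 0" if "i \<in> I" "p \<in> D" for i p
  proof (rule ccontr)
    assume "\<not> F i p > 0"
    \<comment> \<open>One bad set for all four inequalities: before its earliest time all of them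
      hold strictly, and recovering u > 0 needs the lower bounds for both invariants.\<close>
    define B where "B = (\<Union>i\<in>I. {p \<in> D. F i p \<le> 0})"
    have "compact B" unfolding B_def
    proof (rule compact_UN)
      show "compact {p \<in> D. F i p \<le> 0}" for i
        using compact_Int_closed[OF \<open>compact D\<close>
            continuous_on_closed_Collect_le[OF cont continuous_on_const \<open>closed D\<close>, of i 0]]
        by (simp add: Int_def)
    qed (simp add: I_def)
    moreover have "p \<in> B" using that \<open>\<not> F i p > 0\<close> unfolding B_def by (intro UN_I[of i]) auto
    then have "B \<noteq> {}" by auto
    ultimately obtain q where "q \<in> B" and qmin: "\<And>p. p \<in> B \<Longrightarrow> fst q \<le> fst p"
      using continuous_attains_inf[OF _ _ continuous_on_fst[OF continuous_on_id]] by metis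
    obtain t y where q: "q = (t, y)" by force
    obtain s \<sigma> where i: "s \<in> {-1, 1}" "\<sigma> \<in> {-1, 1}" and tyD: "(t, y) \<in> D" and "F (s, \<sigma>) (t, y) \<le> 0"
      using \<open>q \<in> B\<close> by (auto simp: B_def q I_def)
    note ty = D_strip[OF tyD]
    have earlier: "F (s', \<sigma>') (t', y') > 0"
      if "t' < t" "(t', y') \<in> D" "s' \<in> {-1, 1}" "\<sigma>' \<in> {-1, 1}" for t' y' s' \<sigma>'
    proof (rule ccontr)
      assume "\<not> ?thesis"
      then have "(t', y') \<in> B" using that unfolding B_def I_def by (intro UN_I[of "(s', \<sigma>')"]) auto
      from qmin[OF this] that show False by (simp add: q)
    qed
    have "t \<noteq> 0"
    proof
      assume "t = 0"
      then have "F (s, \<sigma>) (t, y) > 0"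
        using init[of y s] i ty by (auto simp: F_def \<psi>_def)
      then show False using \<open>F (s, \<sigma>) (t, y) \<le> 0\<close> by simp
    qed
    then have "t > 0" using ty by simp
    \<comment> \<open>The time sections of \<open>D\<close> shrink as time grows, so the vertical
      segment below a point of \<open>D\<close> stays in \<open>D\<close>.\<close>
    have below: "(\<tau>, y) \<in> D" if "0 \<le> \<tau>" "\<tau> \<le> t" for \<tau>
    proof -
      have "x * exp (- (2 * L * T)) * exp (2 * L * \<tau>) \<le> x * exp (- (2 * L * T)) * exp (2 * L * t)"
        "r * exp (- (2 * L * t)) \<le> r * exp (- (2 * L * \<tau>))"
        using that L x r0 by (auto intro!: mult_left_mono)
      then show ?thesis using tyD that by (auto simp: D_def)
    qed
    \<comment> \<open>Before time \<open>t\<close> both invariants exceed a positive barrier, hence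
      so does their mean u_t, and \<open>u\<close> has increased from its positive initial
      value.\<close>
    have u_pos: "u t y > 0"
    proof -
      obtain \<xi> where \<xi>: "\<xi> \<in> {0<..<t}" and mv: "u t y - u 0 y = (t - 0) * Dt T u \<xi> y"
        by (rule real_mvt[of 0 t "{0..T}" "\<lambda>s. u s y" "\<lambda>s. Dt T u s y"])
          (use \<open>t > 0\<close> ty in \<open>auto intro!: Dt_has_derivative[OF C(1)]\<close>)
      have "F (1, -1) (\<xi>, y) > 0" "F (-1, -1) (\<xi>, y) > 0"
        using \<xi> by (auto intro!: earlier below)
      then have "Dt T u \<xi> y > 0"
        using \<psi>_pos[of y "-1" \<xi>] ty by (simp add: F_def riemann_inv_def)
      then have "u t y - u 0 y > 0" unfolding mv using \<open>t > 0\<close> by simp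
      then show ?thesis using pos0[of y] ty by simp
    qed
    define k where "k = u t y powr a"
    define b where "b = a * u t y powr (a - 1) * Dx \<delta> u t y"
    have k: "0 < k" "k \<le> L * y" using u_pos speed[of t y] ty by (auto simp: k_def)
    have b: "\<bar>b\<bar> \<le> L"
      using bound[of t y] ty u_pos a
      by (auto simp: b_def L_def rpow_def abs_mult mult.assoc split: if_splits)
    \<comment> \<open>The bound \<open>t\<close> keeps times nonnegative; 1 / (2 L) gives
      \<open>2 * L * h \<le> 1\<close>, needed for the left edge of \<open>D\<close>.\<close>
    define e where "e = min t (1 / (2 * L))"
    have e: "0 < e" "e \<le> t" "e \<le> 1 / (2 * L)" using \<open>t > 0\<close> L by (auto simp: e_def)
    have line: "(t - h, y + s * k * h) \<in> D" if h: "h \<in> {0..e}" for h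
    proof -
      have "h \<le> 1 / (2 * L)" using h e by simp
      then have Lh: "0 \<le> L * h" "2 * L * h \<le> 1" using h L by (auto simp: field_simps)
      have ex: "exp (2 * L * h) \<ge> 1 + 2 * L * h" by (rule exp_ge_add_one_self)
      have "(1 - L * h) * exp (2 * L * h) \<ge> (1 - L * h) * (1 + 2 * L * h)"
        using Lh ex by (intro mult_left_mono) auto
      moreover have "(1 - L * h) * (1 + 2 * L * h) = 1 + L * h * (1 - 2 * L * h)"
        by (simp add: algebra_simps)
      moreover have "L * h * (1 - 2 * L * h) \<ge> 0" by (rule mult_nonneg_nonneg[OF Lh(1)]) (use Lh in simp)
      ultimately have ex2: "1 - L * h \<ge> exp (- (2 * L * h))" by (simp add: exp_minus field_simps)
      have "\<bar>s * k * h\<bar> = k * h" using i k h by auto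
      also have "\<dots> \<le> L * y * h" using k h by (intro mult_right_mono) auto
      finally have skh: "\<bar>s * k * h\<bar> \<le> y * (L * h)" by (simp add: mult_ac)
      have "y + s * k * h \<le> y * (1 + L * h)" using skh by (simp add: algebra_simps abs_le_iff)
      also have "\<dots> \<le> y * exp (2 * L * h)" using ty by (intro mult_left_mono[OF order_trans[OF _ ex]]) (use Lh in auto)
      also have "\<dots> \<le> r * exp (- (2 * L * t)) * exp (2 * L * h)"
        using tyD by (intro mult_right_mono) (auto simp: D_def)
      also have "\<dots> = r * exp (- (2 * L * (t - h)))"
        by (simp add: exp_add[symmetric] algebra_simps)
      finally have up: "y + s * k * h \<le> r * exp (- (2 * L * (t - h)))" .
      have "x * exp (- (2 * L * T)) * exp (2 * L * (t - h))
          = x * exp (- (2 * L * T)) * exp (2 * L * t) * exp (- (2 * L * h))"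
        by (simp add: exp_add[symmetric] algebra_simps)
      also have "\<dots> \<le> y * exp (- (2 * L * h))"
        using tyD by (intro mult_right_mono) (auto simp: D_def)
      also have "\<dots> \<le> y * (1 - L * h)" using ex2 ty by (intro mult_left_mono) auto
      also have "\<dots> \<le> y + s * k * h" using skh by (simp add: algebra_simps abs_le_iff)
      finally show ?thesis using up h e ty by (auto simp: D_def)
    qed
    let ?g = "\<lambda>h. F (s, \<sigma>) (t - h, y + s * k * h)"
    let ?R = "riemann_inv a T \<delta> u s t y"
    \<comment> \<open>Along the segment y^\<beta> changes at relative rate \<beta> s k / y, while
      the exponential contributes -\<sigma> K because time runs backward.\<close>
    define d where "d = \<sigma> * (\<psi> \<sigma> t y * (\<beta> * s * k / y - \<sigma> * K) + s * b * ?R)"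
    have dR: "((\<lambda>h. riemann_inv a T \<delta> u s (t - h) (y + s * k * h)) has_real_derivative - (s * b * ?R))
        (at 0 within {0..e})"
      unfolding k_def b_def
    proof (rule riemann_inv_line_derivative[OF u eq])
      show "t - h \<in> {0..T} \<and> y + s * u t y powr a * h \<in> {0<..\<delta>}" if "h \<in> {0..e}" for h
        using D_strip[OF line[OF that]] by (auto simp: k_def)
    qed (use \<open>t > 0\<close> ty u_pos i e in auto)
    have "((\<lambda>h. (y + s * k * h) powr \<beta> * exp (\<sigma> * K * (t - h))) has_real_derivative
        (\<beta> * y powr (\<beta> - 1) * (s * k)) * exp (\<sigma> * K * t)
        + (- (\<sigma> * K) * exp (\<sigma> * K * t)) * y powr \<beta>) (at 0)"
      using ty by (auto intro!: derivative_eq_intros)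
    from DERIV_cmult[OF DERIV_diff[OF DERIV_cmult[OF DERIV_subset[OF this], of "{0..e}"
          "if \<sigma> = 1 then c2 else c1"] dR], of \<sigma>]
    have "(?g has_real_derivative \<sigma> * ((if \<sigma> = 1 then c2 else c1) *
        ((\<beta> * y powr (\<beta> - 1) * (s * k)) * exp (\<sigma> * K * t)
        + (- (\<sigma> * K) * exp (\<sigma> * K * t)) * y powr \<beta>) - - (s * b * ?R))) (at 0 within {0..e})"
      unfolding F_def \<psi>_def by (simp add: mult.assoc)
    then have dg: "(?g has_real_derivative d) (at 0 within {0..e})"
      using ty unfolding d_def \<psi>_def by (auto elim!: DERIV_cong simp: powr_diff field_simps)
    show False
    proof (rule first_time_contradiction[OF e(1) dg])
      show "?g h > 0" if "0 < h" "h \<le> e" for h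
        using that i by (intro earlier line) auto
      show "?g 0 \<le> 0" using \<open>F (s, \<sigma>) (t, y) \<le> 0\<close> by simp
      assume "?g 0 = 0"
      \<comment> \<open>At contact the invariant equals the barrier, so \<open>d\<close> is a
        multiple of \<open>\<psi>\<close>, and the choice of \<open>K\<close> decides its
        sign.\<close>
      then have "?R = \<psi> \<sigma> t y" using i by (auto simp: F_def)
      then have d: "d = \<psi> \<sigma> t y * (\<sigma> * s * (\<beta> * (k / y) + b) - K)"
        using i by (auto simp: d_def algebra_simps)
      have "\<bar>\<sigma> * s * (\<beta> * (k / y) + b)\<bar> = \<bar>\<beta> * (k / y) + b\<bar>"
        using i by (auto simp: abs_mult)
      also have "\<dots> \<le> \<beta> * (k / y) + \<bar>b\<bar>"
        using abs_triangle_ineq[of "\<beta> * (k / y)" b] k ty \<beta> by simp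
      also have "\<dots> \<le> \<beta> * L + L"
        using k ty \<beta> b by (intro add_mono mult_left_mono) (auto simp: field_simps)
      also have "\<dots> < K" using K by (simp add: mult.commute)
      finally show "d < 0"
        unfolding d using \<psi>_pos ty by (intro mult_pos_neg) auto
    qed
  qed
  \<comment> \<open>The left edge of \<open>D\<close> increases to exactly \<open>x\<close> at time
    \<open>T\<close>, and the right edge decreases to r exp(-2 L T), which is at least
    \<open>x\<close>.\<close>
  have "(t, x) \<in> D"
  proof -
    have "x * exp (- (2 * L * T)) * exp (2 * L * t) \<le> x * 1"
      using t L x unfolding mult.assoc exp_add[symmetric] by (intro mult_left_mono) auto
    moreover have "r * exp (- (2 * L * T)) \<le> r * exp (- (2 * L * t))"
      using t L r0 by (intro mult_left_mono) auto
    ultimately show ?thesis using t x by (simp add: D_def)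
  qed
  then have "F (s, \<sigma>) (t, x) > 0" if "s \<in> {-1, 1}" "\<sigma> \<in> {-1, 1}" for s \<sigma>
    using that by (intro F_pos) (auto simp: I_def)
  from this[of 1 1] this[of "-1" 1] this[of 1 "-1"] this[of "-1" "-1"]
  show "c1 * x powr \<beta> * exp (- (K * t)) < Dt T u t x"
    and "Dt T u t x < c2 * x powr \<beta> * exp (K * t)"
    by (simp_all add: F_def \<psi>_def riemann_inv_def)
qed

section \<open>Initial data, choice of constants and integration in time\<close>

theorem theorem1p2:
  fixes a \<alpha> \<beta> T \<delta> K0 K1 K2 K3 :: real
    and u0 u1 :: "real \<Rightarrow> real"
    and u ut :: "real \<Rightarrow> real \<Rightarrow> real"
  assumes "a \<ge> 1" and "\<alpha> > \<beta>" and "\<beta> > 0" and "T > 0" and "\<delta> > 0"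
    and "K0 > 0" and "K1 > 0" and "K2 > 0" and "K3 > 0"
    and "\<And>x. x \<in> {0..\<delta>} \<Longrightarrow> K0 * x powr \<alpha> \<le> u0 x \<and> u0 x \<le> K1 * x powr \<alpha>"
    and "\<And>x. x \<in> {0..\<delta>} \<Longrightarrow> K2 * x powr \<beta> \<le> u1 x \<and> u1 x \<le> K3 * x powr \<beta>"
    and "C2_strip T \<delta> u"
    and "continuous_on ({0..T} \<times> {0..\<delta>}) (\<lambda>(t, x). u t x)"
    and "continuous_extension T \<delta> (Dt T u) ut"
    and "\<exists>w. continuous_extension T \<delta> (\<lambda>t x. rpow (u t x) (a - 1) * Dx \<delta> u t x) w"
    and "solves_wave_eq a T \<delta> u"
    and "\<And>x. x \<in> {0..\<delta>} \<Longrightarrow> u 0 x = u0 x"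
    and "\<And>x. x \<in> {0..\<delta>} \<Longrightarrow> ut 0 x = u1 x"
    and "\<And>t. t \<in> {0..T} \<Longrightarrow> u t 0 = 0 \<and> ut t 0 = 0"
    and "\<And>t x. t \<in> {0..T} \<Longrightarrow> x \<in> {0..\<delta>} \<Longrightarrow> u t x \<ge> 0"
  shows "\<exists>T1 \<delta>1 C1 C2. 0 < T1 \<and> T1 \<le> T \<and> 0 < \<delta>1 \<and> \<delta>1 < \<delta> \<and> C1 > 0 \<and> C2 > 0 \<and>
    (\<forall>t\<in>{0..T1}. \<forall>x\<in>{0..\<delta>1}. C1 * t * x powr \<beta> \<le> u t x \<and> u t x \<le> C2 * x powr \<beta>)"
proof -
  note u0 = assms(10) and u1 = assms(11) and u = assms(12) and cont = assms(13) and ut = assms(14)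
    and ex_w = assms(15) and eq = assms(16) and init_u = assms(17) and init_ut = assms(18)
    and zero = assms(19) and nonneg = assms(20)
  note pos = assms(1-9)
  note C = C2_stripD[OF u]
  obtain w where w: "continuous_extension T \<delta> (\<lambda>t x. rpow (u t x) (a - 1) * Dx \<delta> u t x) w"
    using ex_w by blast
  have "compact ((\<lambda>(t, x). w t x) ` ({0..T} \<times> {0..\<delta>}))"
    using w by (intro compact_continuous_image compact_Times compact_Icc)
      (simp add: continuous_extension_def)
  then obtain M where M: "M > 0" and w_le: "\<And>p. p \<in> {0..T} \<times> {0..\<delta>} \<Longrightarrow> \<bar>(\<lambda>(t, x). w t x) p\<bar> \<le> M"
    using compact_imp_bounded bounded_pos by (metis (no_types, lifting) imageI real_norm_def)
  have bound: "\<bar>rpow (u t y) (a - 1) * Dx \<delta> u t y\<bar> \<le> M" if "t \<in> {0..T}" "y \<in> {0<..\<delta>}" for t y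
    using w_le[of "(t, y)"] w that by (auto simp: continuous_extension_def)
  have nonneg': "u t y \<ge> 0" if "t \<in> {0..T}" "y \<in> {0<..\<delta>}" for t y
    using nonneg that by simp
  define L K where "L = a * M" and "K = a * M * (1 + \<beta>) + 1"
  have K: "K > 0" using pos M by (simp add: K_def add_pos_pos)
  have L: "L > 0" using pos M by (simp add: L_def)
  have speed: "u t y powr a \<le> a * M * y" if "t \<in> {0..T}" "y \<in> {0<..\<delta>}" for t y
  proof (rule speed_bound[OF C(1) \<open>a \<ge> 1\<close> that(1)])
    have "continuous_on {0..\<delta>} (\<lambda>y. (\<lambda>(t, x). u t x) (t, y))"
      by (rule continuous_on_compose2[OF cont]) (use that in \<open>auto intro!: continuous_intros\<close>)
    then show "continuous_on {0..\<delta>} (u t)" by simp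
  qed (use that zero nonneg bound in auto)
  \<comment> \<open>The second entry makes M K1 y^(\<alpha>-\<beta>) at most K2 / 4 on (0, r],
    leaving strict room below K2 / 2; the first ensures \<open>r < \<delta>\<close>.\<close>
  define r where "r = min (\<delta> / 2) ((K2 / (4 * M * K1)) powr (1 / (\<alpha> - \<beta>)))"
  have r: "0 < r" "r < \<delta>" using pos M by (auto simp: r_def min_def)
  have powr_split: "y powr \<alpha> = y powr (\<alpha> - \<beta>) * y powr \<beta>" for y :: real
    by (simp add: powr_add[symmetric])
  have small: "M * (K1 * y powr \<alpha>) < K2 / 2 * y powr \<beta>" if y: "y \<in> {0<..r}" for y
  proof -
    have "y powr (\<alpha> - \<beta>) \<le> ((K2 / (4 * M * K1)) powr (1 / (\<alpha> - \<beta>))) powr (\<alpha> - \<beta>)"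
      using y pos by (intro powr_mono2) (auto simp: r_def)
    also have "\<dots> = K2 / (4 * M * K1)" using pos M by (simp add: powr_powr)
    finally have "M * K1 * y powr (\<alpha> - \<beta>) \<le> M * K1 * (K2 / (4 * M * K1))"
      using pos M by (intro mult_left_mono) auto
    also have "\<dots> < K2 / 2" using pos M by simp
    finally have "M * K1 * y powr (\<alpha> - \<beta>) * y powr \<beta> < K2 / 2 * y powr \<beta>"
      using y by (intro mult_strict_right_mono) auto
    then show ?thesis by (simp add: powr_split[of y] mult.assoc)
  qed
  have u0_pos: "u 0 y > 0" if "y \<in> {0<..r}" for y
  proof -
    have "0 < K0 * y powr \<alpha>" using that pos by simp
    also have "\<dots> \<le> u 0 y" using u0[of y] init_u[of y] that r by simp
    finally show ?thesis .
  qed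
  \<comment> \<open>The term u^a u_x is smaller than half of K2 y^\<beta>, so it costs at most half
    of the lower constant and adds less than K2 to the upper one.\<close>
  have init: "K2 / 2 * y powr \<beta> < riemann_inv a T \<delta> u s 0 y
      \<and> riemann_inv a T \<delta> u s 0 y < (K3 + K2) * y powr \<beta>"
    if y: "y \<in> {0<..r}" and s: "s \<in> {-1, 1}" for y s
  proof -
    have y': "y \<in> {0<..\<delta>}" "y \<in> {0..\<delta>}" and T0: "0 \<in> {0..T}" using y r pos by auto
    have "Dt T u 0 y = u1 y"
      using ut init_ut[OF y'(2)] y' T0 by (auto simp: continuous_extension_def)
    then have R: "riemann_inv a T \<delta> u s 0 y = u1 y + s * (u 0 y powr a * Dx \<delta> u 0 y)"
      by (simp add: riemann_inv_def mult.assoc)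
    \<comment> \<open>One factor \<open>u\<close> is split off to use the decay of u0, leaving the
      bounded coefficient; \<open>rpow\<close> covers \<open>a = 1\<close> as well.\<close>
    have "u 0 y powr a = u 0 y * rpow (u 0 y) (a - 1)"
      using u0_pos[OF y] powr_mult_base[of "u 0 y" "a - 1"] by (auto simp: rpow_def)
    then have "\<bar>u 0 y powr a * Dx \<delta> u 0 y\<bar> = u 0 y * \<bar>rpow (u 0 y) (a - 1) * Dx \<delta> u 0 y\<bar>"
      using u0_pos[OF y] by (simp add: abs_mult)
    also have "\<dots> \<le> K1 * y powr \<alpha> * M"
      using u0[OF y'(2)] init_u[OF y'(2)] u0_pos[OF y] bound[OF T0 y'(1)] by (intro mult_mono) auto
    also have "\<dots> < K2 / 2 * y powr \<beta>" using small[OF y] by (simp add: mult_ac)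
    finally have "\<bar>s * (u 0 y powr a * Dx \<delta> u 0 y)\<bar> < K2 / 2 * y powr \<beta>"
      using s by (auto simp: abs_mult)
    moreover have "K2 * y powr \<beta> > 0" using y pos by simp
    ultimately show ?thesis
      unfolding R distrib_right using conjunct1[OF u1[OF y'(2)]] conjunct2[OF u1[OF y'(2)]]
      by (intro conjI; linarith)
  qed
  define \<delta>1 where "\<delta>1 = r * exp (- (2 * L * T))"
  define C1 where "C1 = K2 / 2 * exp (- (K * T))"
  \<comment> \<open>The first summand bounds u0 through x^\<alpha> \<le> \<delta>^(\<alpha>-\<beta>)
    x^\<beta>, the second the time integral of u_t.\<close>
  define C2 where "C2 = K1 * \<delta> powr (\<alpha> - \<beta>) + T * ((K3 + K2) * exp (K * T))"
  have "\<delta>1 \<le> r * 1" unfolding \<delta>1_def using r L pos by (intro mult_left_mono) auto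
  then have \<delta>1: "\<delta>1 < \<delta>" "0 < \<delta>1" using r by linarith (use r in \<open>simp add: \<delta>1_def\<close>)
  have Cpos: "C1 > 0" "C2 > 0" using pos by (auto simp: C1_def C2_def intro!: add_pos_pos)
  have Dt_bounds: "C1 * x powr \<beta> \<le> Dt T u t x" "Dt T u t x \<le> (K3 + K2) * exp (K * T) * x powr \<beta>"
    if t: "t \<in> {0..T}" and x: "x \<in> {0<..\<delta>1}" for t x
  proof -
    have "K2 / 2 > 0" "K3 + K2 > 0" "0 < x" "x \<le> r * exp (- (2 * (a * M) * T))"
      using pos x by (auto simp: \<delta>1_def L_def)
    note bounds = riemann_inv_bounds[OF pos(1,3,4) M u eq nonneg' bound speed this(1,2) r(2)
        u0_pos init this(3,4) t, folded K_def]
    then have "K2 / 2 * x powr \<beta> * exp (- (K * t)) < Dt T u t x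
      \<and> Dt T u t x < (K3 + K2) * x powr \<beta> * exp (K * t)" by blast
    moreover have "K2 / 2 * x powr \<beta> * exp (- (K * T)) \<le> K2 / 2 * x powr \<beta> * exp (- (K * t))"
      "(K3 + K2) * x powr \<beta> * exp (K * t) \<le> (K3 + K2) * x powr \<beta> * exp (K * T)"
      using t K pos by (auto intro!: mult_left_mono)
    ultimately show "C1 * x powr \<beta> \<le> Dt T u t x" "Dt T u t x \<le> (K3 + K2) * exp (K * T) * x powr \<beta>"
      by (auto simp: C1_def mult_ac)
  qed
  have "C1 * t * x powr \<beta> \<le> u t x \<and> u t x \<le> C2 * x powr \<beta>"
    if t: "t \<in> {0..T}" and x: "x \<in> {0..\<delta>1}" for t x
  proof (cases "x = 0")
    \<comment> \<open>Here \<open>0 powr \<beta> = 0\<close>, so both bounds and \<open>u\<close>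
      vanish.\<close>
    case True
    then show ?thesis using zero[OF t] by simp
  next
    case False
    then have x0: "x \<in> {0<..\<delta>1}" "x \<in> {0<..\<delta>}" "x \<in> {0..\<delta>}" using x \<delta>1 by auto
    have "\<exists>\<xi>\<in>{0..T}. u t x - u 0 x = t * Dt T u \<xi> x"
    proof (cases "t = 0")
      case False
      obtain \<xi> where "\<xi> \<in> {0<..<t}" "u t x - u 0 x = (t - 0) * Dt T u \<xi> x"
        by (rule real_mvt[of 0 t "{0..T}" "\<lambda>s. u s x" "\<lambda>s. Dt T u s x"])
          (use t x0 False in \<open>auto intro!: Dt_has_derivative[OF C(1)]\<close>)
      then show ?thesis using t by (intro bexI[of _ \<xi>]) auto
    qed (use pos in auto)
    then obtain \<xi> where \<xi>: "\<xi> \<in> {0..T}" and mv: "u t x - u 0 x = t * Dt T u \<xi> x" by blast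
    note B = Dt_bounds[OF \<xi> x0(1)]
    have "t * (C1 * x powr \<beta>) \<le> t * Dt T u \<xi> x" using B(1) t by (intro mult_left_mono) auto
    moreover have "u 0 x \<ge> 0" using nonneg x0 pos by simp
    ultimately have low: "C1 * t * x powr \<beta> \<le> u t x" using mv by (simp add: mult_ac)
    have "t * Dt T u \<xi> x \<le> T * ((K3 + K2) * exp (K * T) * x powr \<beta>)"
    proof (rule mult_mono[OF _ B(2)])
      show "0 \<le> Dt T u \<xi> x"
        using B(1) Cpos by (meson less_imp_le mult_nonneg_nonneg order_trans powr_ge_zero)
    qed (use t pos in auto)
    moreover have "u 0 x \<le> K1 * \<delta> powr (\<alpha> - \<beta>) * x powr \<beta>"
    proof -
      have "u 0 x \<le> K1 * x powr (\<alpha> - \<beta>) * x powr \<beta>"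
        using u0[OF x0(3)] init_u[OF x0(3)] by (simp add: powr_split[of x] mult.assoc)
      also have "\<dots> \<le> K1 * \<delta> powr (\<alpha> - \<beta>) * x powr \<beta>"
        using x0 pos by (intro mult_right_mono mult_left_mono powr_mono2) auto
      finally show ?thesis .
    qed
    ultimately have "u t x \<le> C2 * x powr \<beta>"
      using mv by (simp add: C2_def algebra_simps)
    with low show ?thesis by simp
  qed
  \<comment> \<open>The full time interval is admissible: the factor exp(-2 L T) in
    \<open>\<delta>1\<close> shrinks the spatial interval instead.\<close>
  with \<open>T > 0\<close> \<delta>1 Cpos show ?thesis
    by (intro exI[of _ T] exI[of _ \<delta>1] exI[of _ C1] exI[of _ C2]) auto
qed

end
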